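(* Let $X$ be a topological space and let $A$ be a well-covered functionally closed subset of $X$. Then $A$ is an $L$-retract in $X$.
   Context: For a topological space $Z$, $C_p(Z)$ denotes the space of all continuous functions $y:Z\to\mathbb R$ with the topology of pointwise convergence. Subsets carry the subspace topology. A subset of $X$ is functionally closed if it has the form $g^{-1}(0)$ for some continuous $g:X\to\mathbb R$, and functionally open if its complement is functionally closed. For a topological space $Z$ let $\pi_Z:Z\to C_p(C_p(Z))$ be given by $\pi_Z(z)(y)=y(z)$, and let $L(Z)$ be the linear subspace of $C_p(C_p(Z))$ (with the subspace topology) consisting of all finite linear combinations $\alpha_1\pi_Z(z_1)+\cdots+\alpha_n\pi_Z(z_n)$ with $n\in\omega$, $z_1,\dots,z_n\in Z$, $\alpha_1,\dots,\alpha_n\in\mathbb R$. A subset $A$ of $X$ is an $L$-retract in $X$ if there exists a continuous mapping $\psi:X\to L(A)$ with $\psi(a)=\pi_A(a)$ for every $a\in A$. A subset $A$ of $X$ is well-covered in $X$ if there exist a sequence, indexed by $n\in\omega$, of families $(U(n,i):i\in I_n)$ of functionally open subsets of $X$, each family being locally finite in $X$ and covering $A$, and a sequence of families $(\lambda_{n,i}:i\in I_n)$ of continuous mappings $\lambda_{n,i}:\overline{U(n,i)}\to A$ (closure in $X$), such that for every $a\in A$ and every neighborhood $U$ of $a$ in $A$ there exist $n_0\in\omega$ and a neighborhood $U_0$ of $a$ in $X$ such that $\lambda_{n,i}(U(n,i)\cap U_0)\subseteq U$ for every $n\ge n_0$ and every $i\in I_n$. *)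

theory Defs
  imports "HOL-Analysis.Analysis"
begin

text \<open>
  Points of the product topology are extensional functions, so an element of \<open>Cp Z\<close> is a continuous
  real function on \<open>topspace Z\<close>, represented by the value \<open>undefined\<close> outside of it. As \<open>Cp Z\<close> is
  again an abstract topology, the construction can be iterated.
\<close>

definition Cp :: "'a topology \<Rightarrow> ('a \<Rightarrow> real) topology" where
  "Cp Z = subtopology (product_topology (\<lambda>_. euclideanreal) (topspace Z))
            {y. continuous_map Z euclideanreal y}"

definition eval_at :: "'a topology \<Rightarrow> 'a \<Rightarrow> ('a \<Rightarrow> real) \<Rightarrow> real" where
  "eval_at Z z = (\<lambda>y\<in>topspace (Cp Z). y z)"

definition L_carrier :: "'a topology \<Rightarrow> (('a \<Rightarrow> real) \<Rightarrow> real) set" where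
  "L_carrier Z = {\<lambda>y\<in>topspace (Cp Z). \<Sum>k<n. \<alpha> k * eval_at Z (z k) y | (n::nat) \<alpha> z.
                    \<forall>k<n. z k \<in> topspace Z}"

definition L_space :: "'a topology \<Rightarrow> (('a \<Rightarrow> real) \<Rightarrow> real) topology" where
  "L_space Z = subtopology (Cp (Cp Z)) (L_carrier Z)"

definition L_retract_in :: "'a topology \<Rightarrow> 'a set \<Rightarrow> bool" where
  "L_retract_in X A \<longleftrightarrow> A \<subseteq> topspace X \<and>
     (\<exists>\<psi>. continuous_map X (L_space (subtopology X A)) \<psi> \<and>
          (\<forall>a\<in>A. \<psi> a = eval_at (subtopology X A) a))"

definition functionally_closedin :: "'a topology \<Rightarrow> 'a set \<Rightarrow> bool" where
  "functionally_closedin X S \<longleftrightarrow>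
     (\<exists>g. continuous_map X euclideanreal g \<and> S = {x \<in> topspace X. g x = 0})"

definition functionally_openin :: "'a topology \<Rightarrow> 'a set \<Rightarrow> bool" where
  "functionally_openin X S \<longleftrightarrow> S \<subseteq> topspace X \<and> functionally_closedin X (topspace X - S)"

text \<open>
  Local finiteness counts indices, not sets, unlike the library's \<open>locally_finite_in\<close>, which
  concerns unindexed collections.
\<close>

definition locally_finite_family_in :: "'a topology \<Rightarrow> 'i set \<Rightarrow> ('i \<Rightarrow> 'a set) \<Rightarrow> bool" where
  "locally_finite_family_in X I U \<longleftrightarrow> (\<forall>i\<in>I. U i \<subseteq> topspace X) \<and>
     (\<forall>x\<in>topspace X. \<exists>V. openin X V \<and> x \<in> V \<and> finite {i \<in> I. U i \<inter> V \<noteq> {}})"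

text \<open>
  The sets \<open>I n\<close> are arbitrary sets of indices. Since types cannot be quantified over inside a
  definition, the type \<open>'i\<close> they live in is a parameter; a statement which assumes
  \<open>well_covered_in TYPE('i) X A\<close> for a type variable \<open>'i\<close> not occurring in its conclusion thus
  covers families indexed by sets of any type.
\<close>

definition well_covered_in :: "'i itself \<Rightarrow> 'a topology \<Rightarrow> 'a set \<Rightarrow> bool" where
  "well_covered_in (_ :: 'i itself) X A \<longleftrightarrow> A \<subseteq> topspace X \<and>
     (\<exists>(I :: nat \<Rightarrow> 'i set) (U :: nat \<Rightarrow> 'i \<Rightarrow> 'a set) (lam :: nat \<Rightarrow> 'i \<Rightarrow> 'a \<Rightarrow> 'a).
        (\<forall>n. \<forall>i\<in>I n. functionally_openin X (U n i)) \<and>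
        (\<forall>n. locally_finite_family_in X (I n) (U n)) \<and>
        (\<forall>n. A \<subseteq> (\<Union>i\<in>I n. U n i)) \<and>
        (\<forall>n. \<forall>i\<in>I n.
           continuous_map (subtopology X (X closure_of U n i)) (subtopology X A) (lam n i)) \<and>
        (\<forall>a\<in>A. \<forall>V. openin (subtopology X A) V \<and> a \<in> V \<longrightarrow>
           (\<exists>n0 V0. openin X V0 \<and> a \<in> V0 \<and>
              (\<forall>n\<ge>n0. \<forall>i\<in>I n. lam n i ` (U n i \<inter> V0) \<subseteq> V))))"

lemma topspace_Cp:
  "topspace (Cp Z) = {y \<in> extensional (topspace Z). continuous_map Z euclideanreal y}"
  by (auto simp: Cp_def PiE_def)

lemma continuous_map_Cp_apply:
  assumes "z \<in> topspace Z"
  shows "continuous_map (Cp Z) euclideanreal (\<lambda>y. y z)"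
  unfolding Cp_def
  by (intro continuous_map_from_subtopology continuous_map_product_projection assms)

lemma eval_at_in_topspace:
  assumes "z \<in> topspace Z"
  shows "eval_at Z z \<in> topspace (Cp (Cp Z))"
proof -
  have "continuous_map (Cp Z) euclideanreal (eval_at Z z)"
    by (rule continuous_map_eq[OF continuous_map_Cp_apply[OF assms]]) (simp add: eval_at_def)
  then show ?thesis
    by (simp add: topspace_Cp[of "Cp Z"] eval_at_def)
qed

lemma topspace_L_space: "topspace (L_space Z) = L_carrier Z"
proof -
  have "f \<in> topspace (Cp (Cp Z))" if "f \<in> L_carrier Z" for f
  proof -
    from that obtain n :: nat and \<alpha> z where z: "\<forall>k<n. z k \<in> topspace Z"
      and f: "f = (\<lambda>y\<in>topspace (Cp Z). \<Sum>k<n. \<alpha> k * eval_at Z (z k) y)"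
      unfolding L_carrier_def by blast
    have "continuous_map (Cp Z) euclideanreal (eval_at Z (z k))" if "k < n" for k
      using eval_at_in_topspace[of "z k" Z] z that by (simp add: topspace_Cp[of "Cp Z"])
    then have "continuous_map (Cp Z) euclideanreal (\<lambda>y. \<Sum>k<n. \<alpha> k * eval_at Z (z k) y)"
      by (intro continuous_map_sum continuous_map_real_mult) auto
    then have "continuous_map (Cp Z) euclideanreal f"
      by (rule continuous_map_eq) (simp add: f)
    then show ?thesis
      by (simp add: topspace_Cp[of "Cp Z"] f)
  qed
  then show ?thesis
    by (auto simp: L_space_def)
qed

end

theory Submission
  imports Defs
begin

text \<open>
  Write \<open>A\<close> as the zero set of a continuous \<open>g \<ge> 0\<close>, write each \<open>U n i\<close> as \<open>{u n i > 0}\<close> with \<open>u n i\<close>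
  continuous and nonnegative, and let \<open>s n\<close> be the locally finite sum of the \<open>u n i\<close>, so that
  \<open>s n > 0\<close> on \<open>A\<close>. Off \<open>A\<close> the \<open>L\<close>-retraction is
  \<open>\<psi> x = \<Sum>\<^sub>n w n x \<cdot> \<Sum>\<^sub>i (u n i x / s n x) \<cdot> \<pi> (lam n i x)\<close>, where \<open>\<pi>\<close> is evaluation on \<open>C\<^sub>p(A)\<close>; on \<open>A\<close>
  it is \<open>\<pi>\<close> itself.

  The weights \<open>w n\<close> have to select finitely many coverings near each point off \<open>A\<close>, only coverings that
  contain the point, and only late coverings near \<open>A\<close>, with total weight \<open>1\<close> there. The sets
  \<open>\<Union>\<^sub>i U n i\<close> need not decrease, nor shrink to \<open>A\<close>, so each \<open>s n\<close> is first replaced by a function \<open>h n \<le> s n\<close>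
  (called \<open>shrink s n\<close> below) which is positive on \<open>A\<close>, decreases in \<open>n\<close> and is at most \<open>2\<close> to the
  power \<open>-n\<close>. Truncating \<open>h n / g - 1\<close> to the unit interval gives \<open>p n\<close>, which vanishes where
  \<open>h n \<le> g\<close> and equals \<open>1\<close> where \<open>h n \<ge> 2 g > 0\<close>, hence at all points off \<open>A\<close> that are near a given point
  of \<open>A\<close>. Take \<open>w n = p n - p (n + 1)\<close>; these differences telescope (\<open>ex_weights\<close>).

  Continuity of \<open>\<psi>\<close> is pointwise in \<open>y \<in> C\<^sub>p(A)\<close> (\<open>L_retract_in_if_coefficients\<close>). Off \<open>A\<close> the sum is
  locally finite, and each term is continuous although \<open>lam n i\<close> lives only on the closure of \<open>U n i\<close>
  (\<open>tendsto_mult_vanishing\<close>). Near \<open>a \<in> A\<close> the value \<open>\<psi> x y\<close> is an average of values of \<open>y\<close> at points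
  \<open>lam n i x\<close> with large \<open>n\<close>, which are close to \<open>y a\<close>.
\<close>

section \<open>Continuity and finite linear combinations of evaluations\<close>

lemma continuous_map_real_nhdsin:
  "continuous_map X euclideanreal f \<longleftrightarrow> (\<forall>z\<in>topspace X. (f \<longlongrightarrow> f z) (nhdsin X z))"
proof -
  have "(f \<longlongrightarrow> f z) (nhdsin X z) \<longleftrightarrow> (f \<longlongrightarrow> f z) (atin X z)" if "z \<in> topspace X" for z
  proof -
    have "eventually P (nhdsin X z) \<longleftrightarrow> eventually P (atin X z)" if "P z" for P
      using that by (auto simp: eventually_nhdsin eventually_atin)
    then show ?thesis
      by (simp add: tendsto_iff)
  qed
  then show ?thesis
    by (simp add: continuous_map_atin)
qed

lemma eventually_nhdsin_self:
  assumes "eventually P (nhdsin X z)" "z \<in> topspace X"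
  shows "P z"
  using assms by (auto simp: eventually_nhdsin)

lemma eventually_nhdsin_topspace: "\<forall>\<^sub>F x in nhdsin X z. x \<in> topspace X"
  using openin_topspace by (auto simp: eventually_nhdsin)

lemma eventually_nhdsin_open:
  assumes "openin X V" "z \<in> V"
  shows "\<forall>\<^sub>F x in nhdsin X z. x \<in> V"
  using assms by (auto simp: eventually_nhdsin)

text \<open>
  A product \<open>c \<cdot> v\<close> makes sense near a point where \<open>v\<close> is defined only on the closure of the set \<open>D\<close>
  outside which \<open>c\<close> vanishes. Continuity of \<open>v\<close> up to the boundary of \<open>D\<close> keeps it bounded near boundary
  points, where \<open>c\<close> tends to \<open>0\<close>.
\<close>

lemma tendsto_mult_vanishing:
  fixes c v :: "'a \<Rightarrow> real"
  assumes D: "D \<subseteq> topspace X"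
    and c: "(c \<longlongrightarrow> c z) (nhdsin X z)"
    and zero: "\<And>x. x \<in> topspace X - D \<Longrightarrow> c x = 0"
    and v: "continuous_map (subtopology X (X closure_of D)) euclideanreal v"
    and z: "z \<in> topspace X"
  shows "((\<lambda>x. c x * v x) \<longlongrightarrow> c z * v z) (nhdsin X z)"
proof -
  let ?C = "X closure_of D"
  have DC: "D \<subseteq> ?C"
    using D by (simp add: closure_of_subset)
  show ?thesis
  proof (cases "z \<in> ?C")
    case True
    \<comment> \<open>Outside the closure, where \<open>c\<close> vanishes, \<open>v\<close> may be replaced by the constant \<open>v z\<close>.\<close>
    define v' where "v' x = (if x \<in> ?C then v x else v z)" for x
    have "(v' \<longlongrightarrow> v z) (nhdsin X z)"
    proof (rule tendstoI)
      fix e :: real assume e: "e > 0"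
      have "(v \<longlongrightarrow> v z) (nhdsin (subtopology X ?C) z)"
        using v True z by (simp add: continuous_map_real_nhdsin)
      then have "\<forall>\<^sub>F x in nhdsin (subtopology X ?C) z. dist (v x) (v z) < e"
        using e by (rule tendstoD)
      then obtain S where "openin (subtopology X ?C) S" "z \<in> S" "\<forall>x\<in>S. dist (v x) (v z) < e"
        using True z by (auto simp: eventually_nhdsin)
      then obtain T where "openin X T" "z \<in> T" "\<forall>x\<in>T \<inter> ?C. dist (v x) (v z) < e"
        by (auto simp: openin_subtopology)
      then show "\<forall>\<^sub>F x in nhdsin X z. dist (v' x) (v z) < e"
        using e by (auto simp: eventually_nhdsin v'_def)
    qed
    then have lim: "((\<lambda>x. c x * v' x) \<longlongrightarrow> c z * v z) (nhdsin X z)"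
      by (intro tendsto_mult c)
    have "\<forall>\<^sub>F x in nhdsin X z. c x * v' x = c x * v x"
      using eventually_nhdsin_topspace
      by eventually_elim (use DC zero in \<open>auto simp: v'_def\<close>)
    then show ?thesis
      by (rule tendsto_cong[THEN iffD1, OF _ lim])
  next
    case False
    have "\<forall>\<^sub>F x in nhdsin X z. x \<in> topspace X - ?C"
      using False z by (intro eventually_nhdsin_open) auto
    then have "\<forall>\<^sub>F x in nhdsin X z. c x * v x = c z * v z"
    proof eventually_elim
      case (elim x)
      then have "c x = 0" "c z = 0"
        using False z DC by (auto intro!: zero)
      then show ?case
        by simp
    qed
    then show ?thesis
      by (rule tendsto_eventually)
  qed
qed

lemma sum_eval_at_in_L_carrier:
  assumes "finite S" "\<And>s. s \<in> S \<Longrightarrow> z s \<in> topspace Z"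
  shows "(\<lambda>y\<in>topspace (Cp Z). \<Sum>s\<in>S. \<alpha> s * y (z s)) \<in> L_carrier Z"
proof -
  obtain h where h: "bij_betw h {..<card S} S"
    using ex_bij_betw_nat_finite[OF \<open>finite S\<close>] by (auto simp: atLeast0LessThan)
  have "(\<Sum>s\<in>S. \<alpha> s * y (z s)) = (\<Sum>k<card S. \<alpha> (h k) * eval_at Z (z (h k)) y)"
    if "y \<in> topspace (Cp Z)" for y
    using sum.reindex_bij_betw[OF h, of "\<lambda>s. \<alpha> s * y (z s)"] that by (simp add: eval_at_def)
  then have "(\<lambda>y\<in>topspace (Cp Z). \<Sum>s\<in>S. \<alpha> s * y (z s)) =
      (\<lambda>y\<in>topspace (Cp Z). \<Sum>k<card S. \<alpha> (h k) * eval_at Z (z (h k)) y)"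
    by (auto simp: restrict_def)
  moreover have "\<forall>k<card S. z (h k) \<in> topspace Z"
    using h assms(2) by (auto simp: bij_betw_def)
  ultimately show ?thesis
    unfolding L_carrier_def mem_Collect_eq
    by (intro exI[of _ "card S"] exI[of _ "\<lambda>k. \<alpha> (h k)"] exI[of _ "\<lambda>k. z (h k)"]) simp
qed

lemma eval_at_in_L_carrier:
  assumes "z \<in> topspace Z"
  shows "eval_at Z z \<in> L_carrier Z"
  using sum_eval_at_in_L_carrier[of "{()}" "\<lambda>_. z" Z "\<lambda>_. 1"] assms by (simp add: eval_at_def)

lemma continuous_map_L_space:
  assumes carrier: "\<And>x. x \<in> topspace X \<Longrightarrow> f x \<in> L_carrier Z"
    and cont: "\<And>y. y \<in> topspace (Cp Z) \<Longrightarrow> continuous_map X euclideanreal (\<lambda>x. f x y)"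
  shows "continuous_map X (L_space Z) f"
proof -
  have "L_carrier Z \<subseteq> topspace (Cp (Cp Z))"
    using topspace_L_space[of Z] by (auto simp: L_space_def)
  then have "f x \<in> topspace (Cp (Cp Z))" if "x \<in> topspace X" for x
    using carrier that by blast
  then have "f x \<in> extensional (topspace (Cp Z))" "continuous_map (Cp Z) euclideanreal (f x)"
    if "x \<in> topspace X" for x
    using that by (simp_all add: topspace_Cp[of "Cp Z"])
  then have "continuous_map X (Cp (Cp Z)) f"
    unfolding Cp_def[of "Cp Z"] continuous_map_in_subtopology continuous_map_componentwise
    using cont by auto
  then show ?thesis
    unfolding L_space_def continuous_map_in_subtopology using carrier by auto
qed

lemma functionally_closedin_imp_closedin:
  assumes "functionally_closedin X S"
  shows "closedin X S"
proof -
  obtain g where "continuous_map X euclideanreal g" "S = {x \<in> topspace X. g x = 0}"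
    using assms by (auto simp: functionally_closedin_def)
  then show ?thesis
    using closedin_continuous_map_preimage[of X euclideanreal g "{0}"] by simp
qed

section \<open>Retracting by means of coefficients\<close>

text \<open>
  The coefficients \<open>c k\<close> form a locally finite family off \<open>A\<close>, and near \<open>A\<close> but off \<open>A\<close> they are a partition
  of unity; on \<open>A\<close> itself they need neither be continuous nor add up to \<open>1\<close>. The last hypothesis says that, as \<open>x\<close> tends to
  \<open>a \<in> A\<close> from outside \<open>A\<close>, all points \<open>lam k x\<close> that carry weight tend to \<open>a\<close>.
\<close>

lemma L_retract_in_if_coefficients:
  fixes X :: "'a topology" and c :: "'k \<Rightarrow> 'a \<Rightarrow> real" and lam :: "'k \<Rightarrow> 'a \<Rightarrow> 'a"
  assumes A: "closedin X A"
    and D: "\<And>k. k \<in> K \<Longrightarrow> D k \<subseteq> topspace X"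
    and lam: "\<And>k. k \<in> K \<Longrightarrow>
      continuous_map (subtopology X (X closure_of D k)) (subtopology X A) (lam k)"
    and nonneg: "\<And>k x. c k x \<ge> 0"
    and zero: "\<And>k x. k \<in> K \<Longrightarrow> x \<in> topspace X - D k \<Longrightarrow> c k x = 0"
    and cont: "\<And>k z. k \<in> K \<Longrightarrow> z \<in> topspace X - A \<Longrightarrow> (c k \<longlongrightarrow> c k z) (nhdsin X z)"
    and locfin: "\<And>z. z \<in> topspace X - A \<Longrightarrow>
      \<exists>F. finite F \<and> F \<subseteq> K \<and> (\<forall>\<^sub>F x in nhdsin X z. \<forall>k\<in>K - F. c k x = 0)"
    and one: "\<And>a. a \<in> A \<Longrightarrow>
      \<forall>\<^sub>F x in nhdsin X a. x \<notin> A \<longrightarrow> (\<Sum>k\<in>{k\<in>K. c k x \<noteq> 0}. c k x) = 1"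
    and near: "\<And>a V. openin (subtopology X A) V \<Longrightarrow> a \<in> V \<Longrightarrow>
      \<forall>\<^sub>F x in nhdsin X a. x \<notin> A \<longrightarrow> (\<forall>k\<in>K. c k x \<noteq> 0 \<longrightarrow> lam k x \<in> V)"
  shows "L_retract_in X A"
proof -
  define Z where "Z = subtopology X A"
  have AX: "A \<subseteq> topspace X"
    using A by (rule closedin_subset)
  then have tZ: "topspace Z = A"
    by (auto simp: Z_def)
  define S where "S x = {k \<in> K. c k x \<noteq> 0}" for x
  define \<psi> where "\<psi> x = (if x \<in> A then eval_at Z x
    else (\<lambda>y\<in>topspace (Cp Z). \<Sum>k\<in>S x. c k x * y (lam k x)))" for x
  have S_fin: "finite (S x)" if x: "x \<in> topspace X - A" for x
  proof -
    obtain F where F: "finite F" "\<forall>\<^sub>F x in nhdsin X x. \<forall>k\<in>K - F. c k x = 0"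
      using locfin[OF x] by blast
    have "\<forall>k\<in>K - F. c k x = 0"
      using eventually_nhdsin_self[OF F(2)] x by blast
    then have "S x \<subseteq> F"
      by (auto simp: S_def)
    then show ?thesis
      using F(1) by (rule finite_subset)
  qed
  have lam_in: "lam k x \<in> A" if "k \<in> S x" "x \<in> topspace X" for k x
  proof -
    have "k \<in> K" "x \<in> D k"
      using that zero[of k x] by (auto simp: S_def)
    then have "x \<in> topspace (subtopology X (X closure_of D k))"
      using D[of k] closure_of_subset[of "D k" X] by auto
    then show ?thesis
      using continuous_map_image_subset_topspace[OF lam[OF \<open>k \<in> K\<close>]] by auto
  qed
  have carrier: "\<psi> x \<in> L_carrier Z" if "x \<in> topspace X" for x
  proof (cases "x \<in> A")
    case True
    then show ?thesis
      by (simp add: \<psi>_def eval_at_in_L_carrier tZ)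
  next
    case False
    then show ?thesis
      using sum_eval_at_in_L_carrier[OF S_fin, of x "\<lambda>k. lam k x" Z] lam_in that
      by (simp add: \<psi>_def tZ)
  qed
  have "continuous_map X euclideanreal (\<lambda>x. \<psi> x y)" if y: "y \<in> topspace (Cp Z)" for y
    unfolding continuous_map_real_nhdsin
  proof
    fix z assume z: "z \<in> topspace X"
    have ycont: "continuous_map Z euclideanreal y"
      using y by (simp add: topspace_Cp)
    have \<psi>_on: "\<psi> x y = y x" if "x \<in> A" for x
      using that y by (simp add: \<psi>_def eval_at_def)
    have \<psi>_off: "\<psi> x y = (\<Sum>k\<in>S x. c k x * y (lam k x))" if "x \<notin> A" for x
      using that y by (simp add: \<psi>_def)
    show "((\<lambda>x. \<psi> x y) \<longlongrightarrow> \<psi> z y) (nhdsin X z)"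
    proof (cases "z \<in> A")
      case False
      then obtain F where F: "finite F" "F \<subseteq> K"
        and Fz: "\<forall>\<^sub>F x in nhdsin X z. \<forall>k\<in>K - F. c k x = 0"
        using locfin[of z] z by blast
      have "\<forall>\<^sub>F x in nhdsin X z. x \<in> topspace X - A"
        using False z A by (intro eventually_nhdsin_open) auto
      with Fz have ev: "\<forall>\<^sub>F x in nhdsin X z. \<psi> x y = (\<Sum>k\<in>F. c k x * y (lam k x))"
      proof eventually_elim
        case (elim x)
        have "(\<Sum>k\<in>S x. c k x * y (lam k x)) = (\<Sum>k\<in>F. c k x * y (lam k x))"
          by (rule sum.mono_neutral_left) (use elim F in \<open>auto simp: S_def\<close>)
        then show ?case
          using elim by (simp add: \<psi>_off)
      qed
      have "((\<lambda>x. \<Sum>k\<in>F. c k x * y (lam k x)) \<longlongrightarrow> (\<Sum>k\<in>F. c k z * y (lam k z))) (nhdsin X z)"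
      proof (rule tendsto_sum)
        fix k assume "k \<in> F"
        then have k: "k \<in> K"
          using F by blast
        have "continuous_map (subtopology X (X closure_of D k)) euclideanreal (\<lambda>x. y (lam k x))"
          using continuous_map_compose[OF lam[OF k] ycont[unfolded Z_def]] by (simp add: o_def)
        then show "((\<lambda>x. c k x * y (lam k x)) \<longlongrightarrow> c k z * y (lam k z)) (nhdsin X z)"
          using k z False by (intro tendsto_mult_vanishing[where D = "D k"] D cont zero) auto
      qed
      then have "((\<lambda>x. \<psi> x y) \<longlongrightarrow> (\<Sum>k\<in>F. c k z * y (lam k z))) (nhdsin X z)"
        by (rule tendsto_cong[THEN iffD2, OF ev])
      then show ?thesis
        using eventually_nhdsin_self[OF ev z] by simp
    next
      case True
      show ?thesis
      proof (rule tendstoI)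
        fix e :: real assume e: "e > 0"
        define V where "V = {b \<in> topspace Z. y b \<in> ball (y z) (e / 2)}"
        have V: "openin (subtopology X A) V"
          unfolding V_def Z_def[symmetric]
          by (rule openin_continuous_map_preimage[OF ycont]) simp
        have zV: "z \<in> V"
          using True e by (simp add: V_def tZ)
        obtain T where T: "openin X T" "V = T \<inter> A"
          using V by (auto simp: openin_subtopology)
        have "\<forall>\<^sub>F x in nhdsin X z. x \<in> T"
          using T zV by (intro eventually_nhdsin_open) auto
        with one[OF True] near[OF V zV] eventually_nhdsin_topspace[of X z]
        show "\<forall>\<^sub>F x in nhdsin X z. dist (\<psi> x y) (\<psi> z y) < e"
        proof eventually_elim
          case (elim x)
          show ?case
          proof (cases "x \<in> A")
            case xA: True
            then have "x \<in> V"
              using T elim by auto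
            then show ?thesis
              using xA True e by (simp add: \<psi>_on V_def dist_commute)
          next
            case xA: False
            have sum1: "(\<Sum>k\<in>S x. c k x) = 1"
              using elim xA by (simp add: S_def)
            have "\<psi> x y - y z = (\<Sum>k\<in>S x. c k x * y (lam k x)) - (\<Sum>k\<in>S x. c k x) * y z"
              using xA sum1 by (simp add: \<psi>_off)
            also have "\<dots> = (\<Sum>k\<in>S x. c k x * (y (lam k x) - y z))"
              by (simp add: sum_distrib_right sum_subtractf right_diff_distrib)
            also have "\<bar>\<dots>\<bar> \<le> (\<Sum>k\<in>S x. c k x * (e / 2))"
            proof (rule order_trans[OF sum_abs], rule sum_mono)
              fix k assume "k \<in> S x"
              then have "lam k x \<in> V"
                using elim xA by (auto simp: S_def)
              then have "\<bar>y (lam k x) - y z\<bar> \<le> e / 2"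
                by (auto simp: V_def dist_real_def abs_minus_commute)
              then show "\<bar>c k x * (y (lam k x) - y z)\<bar> \<le> c k x * (e / 2)"
                using nonneg[of k x] by (simp add: abs_mult mult_left_mono del: times_divide_eq_right)
            qed
            also have "\<dots> = e / 2"
              using sum1 by (metis mult_1 sum_distrib_right)
            also have "\<dots> < e"
              using e by simp
            finally show ?thesis
              using True by (simp add: \<psi>_on dist_real_def)
          qed
        qed
      qed
    qed
  qed
  then have "continuous_map X (L_space Z) \<psi>"
    by (intro continuous_map_L_space carrier)
  then show ?thesis
    unfolding L_retract_in_def Z_def[symmetric] using AX by (auto simp: \<psi>_def)
qed

section \<open>Weights for a sequence of coverings\<close>

text \<open>
  Given functions \<open>s n \<ge> 0\<close>, the functions \<open>shrink s n\<close> are positive where \<open>s 0, \<dots>, s n\<close> are,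
  satisfy \<open>shrink s n \<le> s n\<close>, decrease in \<open>n\<close> and tend to \<open>0\<close> uniformly.
\<close>

primrec shrink :: "(nat \<Rightarrow> 'a \<Rightarrow> real) \<Rightarrow> nat \<Rightarrow> 'a \<Rightarrow> real" where
  "shrink s 0 x = min 1 (s 0 x)"
| "shrink s (Suc n) x = min (shrink s n x / 2) (s (Suc n) x)"

lemma shrink_nonneg: "(\<And>n. s n x \<ge> 0) \<Longrightarrow> shrink s n x \<ge> 0"
  by (induction n) auto

lemma shrink_pos: "(\<And>n. s n x > 0) \<Longrightarrow> shrink s n x > 0"
  by (induction n) auto

lemma shrink_le: "shrink s n x \<le> s n x"
  by (cases n) auto

lemma shrink_le_power: "shrink s n x \<le> (1 / 2) ^ n"
  by (induction n) auto

lemma shrink_Suc_le: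
  assumes "\<And>n. s n x \<ge> 0"
  shows "shrink s (Suc n) x \<le> shrink s n x"
  using shrink_nonneg[of s x n, OF assms] by simp

lemma shrink_antimono:
  assumes "\<And>n. s n x \<ge> 0" "m \<le> n"
  shows "shrink s n x \<le> shrink s m x"
  using assms(2)
proof (induction rule: dec_induct)
  case (step n)
  then show ?case
    using shrink_Suc_le[of s x n, OF assms(1)] by linarith
qed simp

lemma tendsto_shrink:
  assumes "\<And>n. (s n \<longlongrightarrow> s n z) F"
  shows "(shrink s n \<longlongrightarrow> shrink s n z) F"
  by (induction n) (auto intro!: tendsto_intros assms)

text \<open>
  The total weight near \<open>A\<close> is stated through partial sums over all \<open>n < N\<close>, for any \<open>N\<close> from which on the
  weights vanish at the point in question.
\<close>

lemma ex_weights: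
  fixes g :: "'a \<Rightarrow> real" and s :: "nat \<Rightarrow> 'a \<Rightarrow> real"
  assumes g: "continuous_map X euclideanreal g" "\<And>x. g x \<ge> 0"
    and A: "A = {x \<in> topspace X. g x = 0}"
    and s: "\<And>n. continuous_map X euclideanreal (s n)" "\<And>n x. s n x \<ge> 0"
      "\<forall>n. \<forall>x\<in>A. s n x > 0"
  obtains w :: "nat \<Rightarrow> 'a \<Rightarrow> real" where "\<And>n x. w n x \<ge> 0"
    and "\<And>n z. z \<in> topspace X - A \<Longrightarrow> (w n \<longlongrightarrow> w n z) (nhdsin X z)"
    and "\<And>n x. w n x \<noteq> 0 \<Longrightarrow> g x < s n x"
    and "\<And>z. z \<in> topspace X - A \<Longrightarrow> \<exists>N. \<forall>\<^sub>F x in nhdsin X z. \<forall>n\<ge>N. w n x = 0"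
    and "\<And>a m. a \<in> A \<Longrightarrow> \<forall>\<^sub>F x in nhdsin X a. x \<notin> A \<longrightarrow> (\<forall>n<m. w n x = 0)"
    and "\<And>a. a \<in> A \<Longrightarrow>
      \<forall>\<^sub>F x in nhdsin X a. x \<notin> A \<longrightarrow> (\<forall>N. (\<forall>n\<ge>N. w n x = 0) \<longrightarrow> (\<Sum>n<N. w n x) = 1)"
proof -
  \<comment> \<open>On \<open>A\<close> the quotient is a division by \<open>0\<close>, hence \<open>p n\<close> vanishes there.\<close>
  define p where "p n x = max 0 (min 1 (shrink s n x / g x - 1))" for n x
  define w where "w n x = p n x - p (Suc n) x" for n x
  have g_lim: "(g \<longlongrightarrow> g z) (nhdsin X z)" if "z \<in> topspace X" for z
    using g that by (simp add: continuous_map_real_nhdsin)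
  have s_lim: "(shrink s n \<longlongrightarrow> shrink s n z) (nhdsin X z)" if "z \<in> topspace X" for n z
    using s that by (intro tendsto_shrink) (simp add: continuous_map_real_nhdsin)
  have p_mono: "p n x \<le> p m x" if "m \<le> n" for m n x
  proof -
    have "shrink s n x / g x \<le> shrink s m x / g x"
      using shrink_antimono[of s x m n, OF s(2) that] g(2) by (simp add: divide_right_mono)
    then show ?thesis
      by (auto simp: p_def)
  qed
  have p_zero: "p n x = 0" if "shrink s n x \<le> g x" for n x
  proof -
    have "shrink s n x / g x \<le> 1"
      using that g(2)[of x] by (cases "g x = 0") auto
    then show ?thesis
      by (auto simp: p_def)
  qed
  have g_pos: "g x > 0" if "x \<in> topspace X - A" for x
    using that g(2)[of x] by (auto simp: A order.strict_iff_order)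
  have p_one: "\<forall>\<^sub>F x in nhdsin X a. x \<notin> A \<longrightarrow> (\<forall>n\<le>m. p n x = 1)" if a: "a \<in> A" for a m
  proof -
    have aX: "a \<in> topspace X" and "g a = 0"
      using a by (auto simp: A)
    have "((\<lambda>x. shrink s m x - 2 * g x) \<longlongrightarrow> shrink s m a - 2 * g a) (nhdsin X a)"
      by (intro tendsto_intros s_lim g_lim aX)
    moreover have "shrink s m a - 2 * g a > 0"
      using shrink_pos[of s a m] s(3) a \<open>g a = 0\<close> by simp
    ultimately have "\<forall>\<^sub>F x in nhdsin X a. shrink s m x - 2 * g x > 0"
      by (rule order_tendstoD)
    with eventually_nhdsin_topspace[of X a] show ?thesis
    proof eventually_elim
      case (elim x)
      show ?case
      proof (intro impI allI)
        fix n assume "x \<notin> A" "n \<le> m"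
        then have "shrink s m x / g x \<ge> 2"
          using g_pos[of x] elim by (simp add: field_simps)
        then have "p m x = 1"
          by (simp add: p_def)
        then show "p n x = 1"
          using p_mono[OF \<open>n \<le> m\<close>, of x] by (simp add: p_def)
      qed
    qed
  qed
  have p_vanish: "\<exists>N. \<forall>\<^sub>F x in nhdsin X z. \<forall>n\<ge>N. p n x = 0" if z: "z \<in> topspace X - A" for z
  proof -
    obtain N where N: "(1 / 2 :: real) ^ N < g z"
      using real_arch_pow_inv[OF g_pos[OF z], of "1/2"] by auto
    have "\<forall>\<^sub>F x in nhdsin X z. (1 / 2) ^ N < g x"
      using g_lim[of z] z N by (intro order_tendstoD) auto
    then have "\<forall>\<^sub>F x in nhdsin X z. \<forall>n\<ge>N. p n x = 0"
    proof eventually_elim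
      case (elim x)
      show ?case
      proof (intro allI impI p_zero)
        fix n assume "n \<ge> N"
        then show "shrink s n x \<le> g x"
          using shrink_antimono[of s x N n, OF s(2)] shrink_le_power[of s N x] elim by linarith
      qed
    qed
    then show ?thesis ..
  qed
  show thesis
  proof
    show "w n x \<ge> 0" for n x
      using p_mono[of n "Suc n" x] by (simp add: w_def)
  next
    fix n z assume z: "z \<in> topspace X - A"
    have "(p n \<longlongrightarrow> p n z) (nhdsin X z)" for n
      unfolding p_def using g_pos[OF z] z by (intro tendsto_intros s_lim g_lim) auto
    then show "(w n \<longlongrightarrow> w n z) (nhdsin X z)"
      unfolding w_def by (intro tendsto_intros)
  next
    fix n x assume "w n x \<noteq> 0"
    then have "p n x \<noteq> 0"
      using p_mono[of n "Suc n" x] by (auto simp: w_def p_def)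
    then have "g x < shrink s n x"
      using p_zero[of n x] by linarith
    then show "g x < s n x"
      using shrink_le[of s n x] by linarith
  next
    fix z assume "z \<in> topspace X - A"
    then obtain N where "\<forall>\<^sub>F x in nhdsin X z. \<forall>n\<ge>N. p n x = 0"
      using p_vanish by blast
    then have "\<forall>\<^sub>F x in nhdsin X z. \<forall>n\<ge>N. w n x = 0"
      by eventually_elim (simp add: w_def)
    then show "\<exists>N. \<forall>\<^sub>F x in nhdsin X z. \<forall>n\<ge>N. w n x = 0" ..
  next
    fix a m assume "a \<in> A"
    from p_one[OF this, of m] show "\<forall>\<^sub>F x in nhdsin X a. x \<notin> A \<longrightarrow> (\<forall>n<m. w n x = 0)"
      by eventually_elim (simp add: w_def)
  next
    fix a assume a: "a \<in> A"
    from p_one[OF a, of 0] eventually_nhdsin_topspace[of X a]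
    show "\<forall>\<^sub>F x in nhdsin X a. x \<notin> A \<longrightarrow> (\<forall>N. (\<forall>n\<ge>N. w n x = 0) \<longrightarrow> (\<Sum>n<N. w n x) = 1)"
    proof eventually_elim
      case (elim x)
      show ?case
      proof (intro impI allI)
        fix N assume x: "x \<notin> A" and N: "\<forall>n\<ge>N. w n x = 0"
        then obtain M where M: "\<forall>n\<ge>M. p n x = 0"
          using p_vanish[of x] elim eventually_nhdsin_self by fastforce
        have "p n x = p N x" if "n \<ge> N" for n
          using that
        proof (induction rule: dec_induct)
          case (step n)
          then have "w n x = 0"
            using N by blast
          then show ?case
            using step.IH by (simp add: w_def)
        qed simp
        from this[of "max M N"] have "p N x = 0"
          using M by simp
        moreover have "(\<Sum>n<N. w n x) = p 0 x - p N x"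
          unfolding w_def by (rule sum_lessThan_telescope')
        ultimately show "(\<Sum>n<N. w n x) = 1"
          using elim x by simp
      qed
    qed
  qed
qed

section \<open>The retraction\<close>

lemma functionally_openin_cozero:
  assumes "functionally_openin X S"
  obtains u where "continuous_map X euclideanreal u" "\<And>x. u x \<ge> (0::real)"
    "\<And>x. x \<in> topspace X \<Longrightarrow> u x > 0 \<longleftrightarrow> x \<in> S"
proof -
  obtain f where f: "continuous_map X euclideanreal f" "S \<subseteq> topspace X"
    "topspace X - S = {x \<in> topspace X. f x = 0}"
    using assms by (auto simp: functionally_openin_def functionally_closedin_def)
  show thesis
  proof
    show "continuous_map X euclideanreal (\<lambda>x. \<bar>f x\<bar>)"
      using f(1) by (rule continuous_map_real_abs)
    show "\<bar>f x\<bar> > 0 \<longleftrightarrow> x \<in> S" if "x \<in> topspace X" for x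
      using f that by auto
  qed simp
qed

lemma locally_finite_family_eventually:
  assumes "locally_finite_family_in X I U" "z \<in> topspace X"
  obtains J where "finite J" "J \<subseteq> I" "\<forall>\<^sub>F x in nhdsin X z. \<forall>i\<in>I - J. x \<notin> U i"
proof -
  obtain V where V: "openin X V" "z \<in> V" "finite {i \<in> I. U i \<inter> V \<noteq> {}}"
    using assms by (auto simp: locally_finite_family_in_def)
  show thesis
  proof
    show "finite {i \<in> I. U i \<inter> V \<noteq> {}}"
      by (fact V)
    show "\<forall>\<^sub>F x in nhdsin X z. \<forall>i\<in>I - {i \<in> I. U i \<inter> V \<noteq> {}}. x \<notin> U i"
      using eventually_nhdsin_open[OF V(1,2)] by eventually_elim auto
  qed auto
qed

lemma continuous_map_locally_finite_sum:
  fixes u :: "'i \<Rightarrow> 'a \<Rightarrow> real"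
  assumes "locally_finite_family_in X I U"
    and u: "\<And>i. i \<in> I \<Longrightarrow> continuous_map X euclideanreal (u i)"
    and zero: "\<And>i x. i \<in> I \<Longrightarrow> x \<in> topspace X - U i \<Longrightarrow> u i x = 0"
  shows "continuous_map X euclideanreal (\<lambda>x. \<Sum>i\<in>{i \<in> I. u i x \<noteq> 0}. u i x)"
  unfolding continuous_map_real_nhdsin
proof
  fix z assume z: "z \<in> topspace X"
  obtain J where J: "finite J" "J \<subseteq> I" and Jz: "\<forall>\<^sub>F x in nhdsin X z. \<forall>i\<in>I - J. x \<notin> U i"
    using locally_finite_family_eventually[OF assms(1) z] .
  from Jz eventually_nhdsin_topspace[of X z]
  have ev: "\<forall>\<^sub>F x in nhdsin X z. (\<Sum>i\<in>{i \<in> I. u i x \<noteq> 0}. u i x) = (\<Sum>i\<in>J. u i x)"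
  proof eventually_elim
    case (elim x)
    then show ?case
      using J zero[of _ x] by (intro sum.mono_neutral_left) auto
  qed
  have "((\<lambda>x. \<Sum>i\<in>J. u i x) \<longlongrightarrow> (\<Sum>i\<in>J. u i z)) (nhdsin X z)"
    using u J z by (intro tendsto_sum) (auto simp: continuous_map_real_nhdsin)
  then show "((\<lambda>x. \<Sum>i\<in>{i \<in> I. u i x \<noteq> 0}. u i x) \<longlongrightarrow> (\<Sum>i\<in>{i \<in> I. u i z \<noteq> 0}. u i z))
      (nhdsin X z)"
    using eventually_nhdsin_self[OF ev z] by (simp add: tendsto_cong[OF ev])
qed

theorem theorem3p3:
  fixes X :: "'a topology" and A :: "'a set"
  assumes "well_covered_in TYPE('i) X A"
    and "functionally_closedin X A"
  shows "L_retract_in X A"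
proof -
  obtain I :: "nat \<Rightarrow> 'i set" and U :: "nat \<Rightarrow> 'i \<Rightarrow> 'a set" and lam :: "nat \<Rightarrow> 'i \<Rightarrow> 'a \<Rightarrow> 'a"
    where U_open: "\<And>n i. i \<in> I n \<Longrightarrow> functionally_openin X (U n i)"
      and U_fin: "\<And>n. locally_finite_family_in X (I n) (U n)"
      and U_cover: "\<And>n. A \<subseteq> (\<Union>i\<in>I n. U n i)"
      and lam: "\<And>n i. i \<in> I n \<Longrightarrow>
        continuous_map (subtopology X (X closure_of U n i)) (subtopology X A) (lam n i)"
      and lam_near: "\<And>a V. a \<in> A \<Longrightarrow> openin (subtopology X A) V \<Longrightarrow> a \<in> V \<Longrightarrow>
        \<exists>n0 V0. openin X V0 \<and> a \<in> V0 \<and> (\<forall>n\<ge>n0. \<forall>i\<in>I n. lam n i ` (U n i \<inter> V0) \<subseteq> V)"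
    using assms(1) unfolding well_covered_in_def by metis
  obtain g0 where g0: "continuous_map X euclideanreal g0" "A = {x \<in> topspace X. g0 x = 0}"
    using assms(2) by (auto simp: functionally_closedin_def)
  define g where "g x = \<bar>g0 x\<bar>" for x
  have g: "continuous_map X euclideanreal g" "\<And>x. g x \<ge> 0" and A: "A = {x \<in> topspace X. g x = 0}"
    unfolding g_def using g0 by (auto intro: continuous_map_real_abs)
  define cozero where "cozero S v \<longleftrightarrow> continuous_map X euclideanreal v \<and> (\<forall>x. v x \<ge> 0) \<and>
      (\<forall>x\<in>topspace X. v x > 0 \<longleftrightarrow> x \<in> S)" for S and v :: "'a \<Rightarrow> real"
  have "\<exists>v. cozero (U n i) v" if "i \<in> I n" for n i
    using functionally_openin_cozero[OF U_open[OF that]] unfolding cozero_def by metis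
  moreover define u where "u n i = (SOME v. cozero (U n i) v)" for n i
  ultimately have u: "\<And>n i. i \<in> I n \<Longrightarrow> cozero (U n i) (u n i)"
    by (simp add: someI_ex)
  have u_cont: "\<And>n i. i \<in> I n \<Longrightarrow> continuous_map X euclideanreal (u n i)"
    and u_nonneg: "\<And>n i x. i \<in> I n \<Longrightarrow> u n i x \<ge> 0"
    and u_pos: "\<And>n i x. i \<in> I n \<Longrightarrow> x \<in> topspace X \<Longrightarrow> u n i x > 0 \<longleftrightarrow> x \<in> U n i"
    using u by (auto simp: cozero_def)
  have u_zero: "u n i x = 0" if "i \<in> I n" "x \<in> topspace X" "x \<notin> U n i" for n i x
    using u_nonneg[OF that(1), of x] u_pos[OF that(1,2)] that(3) by simp
  define J where "J n x = {i \<in> I n. u n i x \<noteq> 0}" for n x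
  have J_fin: "finite (J n x)" if x: "x \<in> topspace X" for n x
  proof -
    obtain F where F: "finite F" "F \<subseteq> I n" "\<forall>\<^sub>F x in nhdsin X x. \<forall>i\<in>I n - F. x \<notin> U n i"
      using locally_finite_family_eventually[OF U_fin x] .
    have "J n x \<subseteq> F"
      using eventually_nhdsin_self[OF F(3) x] u_zero x by (auto simp: J_def)
    then show ?thesis
      using F(1) by (rule finite_subset)
  qed
  define s where "s n x = (\<Sum>i\<in>J n x. u n i x)" for n x
  have s_cont: "continuous_map X euclideanreal (s n)" for n
    unfolding s_def J_def
    by (rule continuous_map_locally_finite_sum[OF U_fin]) (auto intro: u_cont u_zero)
  have s_nonneg: "s n x \<ge> 0" for n x
    unfolding s_def by (intro sum_nonneg) (auto simp: J_def u_nonneg)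
  have s_pos: "\<forall>n. \<forall>x\<in>A. s n x > 0"
  proof (intro allI ballI)
    fix n x assume xA: "x \<in> A"
    then have x: "x \<in> topspace X"
      by (simp add: A)
    obtain i where i: "i \<in> I n" "x \<in> U n i"
      using U_cover[of n] xA by blast
    then have ui: "u n i x > 0"
      using u_pos x by blast
    then have "i \<in> J n x"
      using i by (simp add: J_def)
    then have "u n i x \<le> s n x"
      unfolding s_def by (rule member_le_sum) (auto simp: J_def u_nonneg J_fin[unfolded J_def] x)
    then show "s n x > 0"
      using ui by linarith
  qed
  obtain w :: "nat \<Rightarrow> 'a \<Rightarrow> real" where w_nonneg: "\<And>n x. w n x \<ge> 0"
    and w_lim: "\<And>n z. z \<in> topspace X - A \<Longrightarrow> (w n \<longlongrightarrow> w n z) (nhdsin X z)"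
    and w_supp: "\<And>n x. w n x \<noteq> 0 \<Longrightarrow> g x < s n x"
    and w_fin: "\<And>z. z \<in> topspace X - A \<Longrightarrow> \<exists>N. \<forall>\<^sub>F x in nhdsin X z. \<forall>n\<ge>N. w n x = 0"
    and w_late: "\<And>a m. a \<in> A \<Longrightarrow> \<forall>\<^sub>F x in nhdsin X a. x \<notin> A \<longrightarrow> (\<forall>n<m. w n x = 0)"
    and w_sum: "\<And>a. a \<in> A \<Longrightarrow>
      \<forall>\<^sub>F x in nhdsin X a. x \<notin> A \<longrightarrow> (\<forall>N. (\<forall>n\<ge>N. w n x = 0) \<longrightarrow> (\<Sum>n<N. w n x) = 1)"
  proof (rule ex_weights[OF g A s_cont s_nonneg s_pos], goal_cases)
    case weights: (1 w)
    show ?case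
      by (rule weights(1)) (fact weights)+
  qed
  define K where "K = Sigma UNIV I"
  \<comment> \<open>Where \<open>w n x \<noteq> 0\<close>, the denominator is \<open>s n x\<close>; the maximum with \<open>g\<close> keeps it positive off \<open>A\<close>.
    The absolute value makes \<open>c\<close> nonnegative also for indices \<open>i \<notin> I n\<close>.\<close>
  define c where "c k x = (case k of (n, i) \<Rightarrow> w n x * \<bar>u n i x\<bar> / max (s n x) (g x))" for k x
  define D where "D k = (case k of (n, i) \<Rightarrow> U n i)" for k
  define lam' where "lam' k = (case k of (n, i) \<Rightarrow> lam n i)" for k
  have c_eq: "c (n, i) x = w n x * \<bar>u n i x\<bar> / max (s n x) (g x)" for n i x
    by (simp add: c_def)
  have max_pos: "max (s n x) (g x) > 0" if "x \<in> topspace X - A" for n x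
    using that g(2)[of x] by (auto simp: A less_max_iff_disj order.strict_iff_order)
  show ?thesis
  proof (rule L_retract_in_if_coefficients[of X A K D lam' c])
    show "closedin X A"
      using assms(2) by (rule functionally_closedin_imp_closedin)
  next
    fix k assume "k \<in> K"
    then obtain n i where k: "k = (n, i)" "i \<in> I n"
      by (auto simp: K_def)
    show "D k \<subseteq> topspace X"
      using U_open[OF k(2)] by (simp add: D_def k functionally_openin_def)
    show "continuous_map (subtopology X (X closure_of D k)) (subtopology X A) (lam' k)"
      using lam[OF k(2)] by (simp add: D_def lam'_def k)
    show "c k x = 0" if "x \<in> topspace X - D k" for x
      using that u_zero[OF k(2)] by (simp add: D_def c_eq k)
    show "(c k \<longlongrightarrow> c k z) (nhdsin X z)" if z: "z \<in> topspace X - A" for z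
    proof -
      have "(u n i \<longlongrightarrow> u n i z) (nhdsin X z)" "(s n \<longlongrightarrow> s n z) (nhdsin X z)"
          "(g \<longlongrightarrow> g z) (nhdsin X z)"
        using u_cont[OF k(2)] s_cont g z by (simp_all add: continuous_map_real_nhdsin)
      then show ?thesis
        unfolding k c_eq using max_pos[OF z, of n]
        by (intro tendsto_intros w_lim z) auto
    qed
  next
    show "c k x \<ge> 0" for k x
      using w_nonneg g(2) s_nonneg by (auto simp: c_def le_max_iff_disj split: prod.split)
  next
    fix z assume z: "z \<in> topspace X - A"
    obtain N where N: "\<forall>\<^sub>F x in nhdsin X z. \<forall>n\<ge>N. w n x = 0"
      using w_fin[OF z] by blast
    have "\<forall>n. \<exists>F. finite F \<and> F \<subseteq> I n \<and> (\<forall>\<^sub>F x in nhdsin X z. \<forall>i\<in>I n - F. x \<notin> U n i)"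
    proof
      fix n
      have "z \<in> topspace X"
        using z by blast
      then obtain F where "finite F" "F \<subseteq> I n" "\<forall>\<^sub>F x in nhdsin X z. \<forall>i\<in>I n - F. x \<notin> U n i"
        by (rule locally_finite_family_eventually[OF U_fin])
      then show "\<exists>F. finite F \<and> F \<subseteq> I n \<and> (\<forall>\<^sub>F x in nhdsin X z. \<forall>i\<in>I n - F. x \<notin> U n i)"
        by blast
    qed
    from choice[OF this] obtain F where F: "\<And>n. finite (F n)" "\<And>n. F n \<subseteq> I n"
      and Fz: "\<And>n. \<forall>\<^sub>F x in nhdsin X z. \<forall>i\<in>I n - F n. x \<notin> U n i"
      by blast
    have "\<forall>\<^sub>F x in nhdsin X z. \<forall>n\<in>{..<N}. \<forall>i\<in>I n - F n. x \<notin> U n i"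
      using Fz by (intro eventually_ball_finite) auto
    with N eventually_nhdsin_topspace[of X z]
    have "\<forall>\<^sub>F x in nhdsin X z. \<forall>k\<in>K - Sigma {..<N} F. c k x = 0"
    proof eventually_elim
      case (elim x)
      show ?case
      proof
        fix k assume "k \<in> K - Sigma {..<N} F"
        then obtain n i where k: "k = (n, i)" "i \<in> I n" "n \<ge> N \<or> i \<notin> F n"
          by (fastforce simp: K_def)
        then show "c k x = 0"
          using elim u_zero[OF k(2), of x] by (cases "n \<ge> N") (auto simp: c_eq)
      qed
    qed
    then show "\<exists>F. finite F \<and> F \<subseteq> K \<and> (\<forall>\<^sub>F x in nhdsin X z. \<forall>k\<in>K - F. c k x = 0)"
      using F by (intro exI[of _ "Sigma {..<N} F"]) (auto simp: K_def)
  next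
    fix a assume a: "a \<in> A"
    from w_sum[OF a] eventually_nhdsin_topspace[of X a]
    show "\<forall>\<^sub>F x in nhdsin X a. x \<notin> A \<longrightarrow> (\<Sum>k\<in>{k \<in> K. c k x \<noteq> 0}. c k x) = 1"
    proof eventually_elim
      case (elim x)
      show ?case
      proof
        assume xA: "x \<notin> A"
        obtain N where N: "\<forall>n\<ge>N. w n x = 0"
          using w_fin[of x] elim xA eventually_nhdsin_self by fastforce
        have "(\<Sum>k\<in>{k \<in> K. c k x \<noteq> 0}. c k x) = (\<Sum>k\<in>Sigma {..<N} (\<lambda>n. J n x). c k x)"
        proof (rule sum.mono_neutral_left)
          show "{k \<in> K. c k x \<noteq> 0} \<subseteq> Sigma {..<N} (\<lambda>n. J n x)"
            using N by (fastforce simp: K_def J_def c_eq not_le[symmetric])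
        qed (use J_fin elim in \<open>auto simp: K_def J_def\<close>)
        also have "\<dots> = (\<Sum>n<N. \<Sum>i\<in>J n x. c (n, i) x)"
          using J_fin elim by (subst sum.Sigma) auto
        also have "\<dots> = (\<Sum>n<N. w n x)"
        proof (rule sum.cong)
          fix n
          have "(\<Sum>i\<in>J n x. c (n, i) x) = w n x * (\<Sum>i\<in>J n x. u n i x) / max (s n x) (g x)"
            unfolding sum_distrib_left sum_divide_distrib
            by (rule sum.cong) (auto simp: c_eq J_def u_nonneg)
          also have "\<dots> = w n x"
            using w_supp[of n x] max_pos[of x n] elim xA
            by (cases "w n x = 0") (auto simp: s_def[symmetric] max_def)
          finally show "(\<Sum>i\<in>J n x. c (n, i) x) = w n x" .
        qed simp
        also have "\<dots> = 1"
          using elim xA N by blast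
        finally show "(\<Sum>k\<in>{k \<in> K. c k x \<noteq> 0}. c k x) = 1" .
      qed
    qed
  next
    fix a V assume V: "openin (subtopology X A) V" "a \<in> V"
    then have a: "a \<in> A"
      using openin_subset by fastforce
    obtain n0 V0 where V0: "openin X V0" "a \<in> V0"
      and sub: "\<forall>n\<ge>n0. \<forall>i\<in>I n. lam n i ` (U n i \<inter> V0) \<subseteq> V"
      using lam_near[OF a V] by blast
    from w_late[OF a, of n0] eventually_nhdsin_open[OF V0] eventually_nhdsin_topspace[of X a]
    show "\<forall>\<^sub>F x in nhdsin X a. x \<notin> A \<longrightarrow> (\<forall>k\<in>K. c k x \<noteq> 0 \<longrightarrow> lam' k x \<in> V)"
    proof eventually_elim
      case (elim x)
      show ?case
      proof (intro impI ballI)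
        fix k assume x: "x \<notin> A" and "k \<in> K" and c: "c k x \<noteq> 0"
        then obtain n i where k: "k = (n, i)" "i \<in> I n"
          by (auto simp: K_def)
        have "w n x \<noteq> 0" "u n i x \<noteq> 0"
          using c by (auto simp: c_eq k)
        then have "n \<ge> n0" "x \<in> U n i"
          using elim x u_zero[OF k(2), of x] by (auto simp: not_less[symmetric])
        then show "lam' k x \<in> V"
          using sub k elim by (auto simp: lam'_def)
      qed
    qed
  qed
qed

end
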